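(* Let $w$ be a weight on $\mathbb{R}^n$, let $1\le p<\infty$, $\lambda_1\ge 0$, $\lambda_2\ge 0$, and $0<\lambda_1 + \lambda_2< n$, and put $\lambda=(\lambda_1,\lambda_2)$. If the Hardy–Littlewood maximal operator $M$ is bounded from $\mathcal L^{p,\lambda}(w)$ to $W\mathcal L^{p,\lambda}(w)$, then $w\in A_{\frac{np+\lambda_1}{n-\lambda_2}}$.
   Context: A weight is a locally integrable function $w$ on $\mathbb{R}^n$ with $w>0$ a.e.; $w(E)=\int_E w$, $|E|$ is Lebesgue measure, $B(x,r)$ is the Euclidean ball. For $\lambda=(\lambda_1,\lambda_2)$, $\mathcal L^{p,\lambda}(w)$ and $W\mathcal L^{p,\lambda}(w)$ are the spaces of measurable $f$ for which, respectively, $$\|f\|_{\mathcal L^{p,\lambda}(w)} := \sup_{x\in \mathbb{R}^n,\, r>0}\left(\frac 1{r^{\lambda_1}\, w(B(x,r))^{\lambda_2/n}}\int_{B(x,r)}|f|^p w\right)^{1/p}<\infty,$$ $$\|f\|_{W\mathcal L^{p,\lambda}(w)}:=\sup_{x\in \mathbb{R}^n,\, r>0,\, t>0}\left(\frac {t^p\,w(\{y\in B(x,r): |f(y)|>t\})}{|B(x,r)|^{\lambda_1/n}\, w(B(x,r))^{\lambda_2/n}}\right)^{1/p}<\infty.$$ $Mf(x)=\sup_{B\ni x}\frac1{|B|}\int_B|f|$, the supremum over balls $B$ containing $x$. Boundedness means $\|Mf\|_{W\mathcal L^{p,\lambda}(w)}\le C\|f\|_{\mathcal L^{p,\lambda}(w)}$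 with $C$ independent of $f$. For $1<q<\infty$, $w\in A_q$ means $\sup_B \frac{w(B)}{|B|} \left( \frac{w^{1-q'}(B)}{|B|} \right)^{q-1}<\infty$, over all balls $B$, where $q'=q/(q-1)$ and $w^{1-q'}(B)=\int_B w^{1-q'}$. *)

theory Defs
  imports "HOL-Analysis.Analysis"
begin

text \<open>The library has no real powers on \<^typ>\<open>ennreal\<close>. The exponent is meant to be nonnegative;
  the value at \<open>\<infinity>\<close> is the right one for positive exponents, and \<open>\<infinity>\<close> is never
  raised to the power \<open>0\<close> below when \<open>w\<close> is a weight.\<close>

definition ennpow :: "ennreal \<Rightarrow> real \<Rightarrow> ennreal"
  where "ennpow a s = (if a = \<infinity> then \<infinity> else ennreal (enn2real a powr s))"

definition weight :: "(real^'n \<Rightarrow> real) \<Rightarrow> bool"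
  where "weight w \<longleftrightarrow>
    (\<forall>K. compact K \<longrightarrow> w absolutely_integrable_on K) \<and> (AE x in lebesgue. 0 < w x)"

definition wmeasure :: "(real^'n \<Rightarrow> real) \<Rightarrow> (real^'n) set \<Rightarrow> ennreal"
  where "wmeasure w E = (\<integral>\<^sup>+x\<in>E. ennreal (w x) \<partial>lebesgue)"

definition morrey_norm :: "real \<Rightarrow> real \<times> real \<Rightarrow> (real^'n \<Rightarrow> real) \<Rightarrow> (real^'n \<Rightarrow> real) \<Rightarrow> ennreal"
  where "morrey_norm p lam w f =
    (SUP (x, r) \<in> UNIV \<times> {0<..}.
      ennpow ((\<integral>\<^sup>+y\<in>ball x r. ennreal (\<bar>f y\<bar> powr p * w y) \<partial>lebesgue)
          / (ennreal (r powr fst lam) * ennpow (wmeasure w (ball x r)) (snd lam / real CARD('n))))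
        (1 / p))"

definition morrey_space :: "real \<Rightarrow> real \<times> real \<Rightarrow> (real^'n \<Rightarrow> real) \<Rightarrow> (real^'n \<Rightarrow> real) set"
  where "morrey_space p lam w = {f \<in> borel_measurable lebesgue. morrey_norm p lam w f < \<infinity>}"

text \<open>The weak norm is applied to maximal functions, which may take the value \<open>\<infinity>\<close>;
  hence its argument is a \<open>[0,\<infinity>]\<close>-valued function, in the role of \<open>\<bar>f\<bar>\<close>.\<close>

definition weak_morrey_norm :: "real \<Rightarrow> real \<times> real \<Rightarrow> (real^'n \<Rightarrow> real) \<Rightarrow> (real^'n \<Rightarrow> ennreal) \<Rightarrow> ennreal"
  where "weak_morrey_norm p lam w g =
    (SUP (x, r, t) \<in> UNIV \<times> {0<..} \<times> {0<..}.
      ennpow (ennreal (t powr p) * wmeasure w {y \<in> ball x r. g y > ennreal t}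
          / (ennpow (emeasure lebesgue (ball x r)) (fst lam / real CARD('n))
             * ennpow (wmeasure w (ball x r)) (snd lam / real CARD('n))))
        (1 / p))"

definition maximal_function :: "(real^'n \<Rightarrow> real) \<Rightarrow> real^'n \<Rightarrow> ennreal"
  where "maximal_function f x =
    (SUP (c, r) \<in> {(c, r). 0 < r \<and> x \<in> ball c r}.
      (\<integral>\<^sup>+y\<in>ball c r. ennreal \<bar>f y\<bar> \<partial>lebesgue) / emeasure lebesgue (ball c r))"

definition maximal_bounded_weak :: "real \<Rightarrow> real \<times> real \<Rightarrow> (real^'n \<Rightarrow> real) \<Rightarrow> bool"
  where "maximal_bounded_weak p lam w \<longleftrightarrow>
    (\<exists>C\<ge>0. \<forall>f \<in> morrey_space p lam w.
       weak_morrey_norm p lam w (maximal_function f) \<le> ennreal C * morrey_norm p lam w f)"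

text \<open>The class \<open>A\<^sub>q\<close> is only meaningful for \<open>1 < q\<close>, so this is part of membership.
  The dual exponent \<open>q' = q / (q - 1)\<close> makes \<open>1 - q'\<close> negative; the factor
  \<open>w\<^bsup>1-q'\<^esup>(B)\<close> may be \<open>\<infinity>\<close>.\<close>

definition muckenhoupt :: "real \<Rightarrow> (real^'n \<Rightarrow> real) set"
  where "muckenhoupt q = {w. weight w \<and> 1 < q \<and>
    (SUP (x, r) \<in> UNIV \<times> {0<..}.
      (wmeasure w (ball x r) / emeasure lebesgue (ball x r))
      * ennpow (wmeasure (\<lambda>y. w y powr (1 - q / (q - 1))) (ball x r)
                / emeasure lebesgue (ball x r)) (q - 1)) < \<infinity>}"

end

theory Submission
  imports Defs
begin

text \<open>
  Write \<open>q\<close> for the target exponent and test the weak-type bound on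
  \<open>f = \<sigma> \<chi>\<^sub>B\<close> with \<open>\<sigma> = w\<^bsup>1-q'\<^esup>\<close>. Since
  \<open>f\<^sup>p w = 1\<^bsup>\<lambda>1/n\<^esup> w\<^bsup>\<lambda>2/n\<^esup> \<sigma>\<^bsup>1-(\<lambda>1+\<lambda>2)/n\<^esup>\<close>
  on \<open>B\<close> for exactly this \<open>q\<close>, Hoelder's inequality with three factors bounds the Morrey norm
  of \<open>f\<close> by a power of \<open>\<sigma>(B)\<close>. On the other hand \<open>M f\<close> is at least the mean
  of \<open>f\<close> on all of \<open>B\<close>, and comparing the two gives the \<open>A\<^sub>q\<close> condition for
  \<open>B\<close>. As \<open>\<sigma>(B)\<close> may a priori be infinite, \<open>\<sigma>\<close> is replaced by
  \<open>min \<sigma> k\<close>, for which the identity above becomes an inequality in the right direction.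
\<close>

section \<open>Weighted AM-GM and Hoelder's inequality with three factors\<close>

text \<open>This is concavity of \<open>ln\<close>: each logarithm lies below the tangent at the
  weighted mean \<open>m\<close>. As the weights add up to 1, the weighted tangents sum to exactly
  \<open>ln m\<close>.\<close>

lemma weighted_am_gm3:
  fixes a b c u v z :: real
  assumes "0 \<le> a" "0 \<le> b" "0 \<le> c" "a + b + c = 1" "0 \<le> u" "0 \<le> v" "0 \<le> z"
  shows "u powr a * v powr b * z powr c \<le> a * u + b * v + c * z"
\<comment> \<open>Since \<open>0 powr s = 0\<close> for every \<open>s\<close>, including 0, the
  left-hand side vanishes as soon as one base does, even if its exponent is 0.\<close>
proof (cases "u = 0 \<or> v = 0 \<or> z = 0")
  case True
  then have "u powr a * v powr b * z powr c = 0" by auto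
  moreover have "0 \<le> a * u + b * v + c * z" using assms by simp
  ultimately show ?thesis by linarith
next
  case False
  then have pos: "0 < u" "0 < v" "0 < z" using assms by auto
  define m where "m = a * u + b * v + c * z"
  have "m \<noteq> 0" using pos assms(1-4) by (auto simp: m_def add_nonneg_eq_0_iff)
  moreover have "0 \<le> m" using assms by (simp add: m_def)
  ultimately have m: "0 < m" by simp
  have tangent: "s * ln y \<le> s * (ln m + (y / m - 1))" if "0 < y" "0 \<le> s" for s y :: real
    using ln_le_minus_one[of "y / m"] that m by (intro mult_left_mono) (auto simp: ln_div)
  have "a * ln u + b * ln v + c * ln z
      \<le> a * (ln m + (u / m - 1)) + b * (ln m + (v / m - 1)) + c * (ln m + (z / m - 1))"
    using assms pos by (intro add_mono tangent)
  also have "\<dots> = (a + b + c) * (ln m - 1) + (a * u + b * v + c * z) / m"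
    by (simp add: algebra_simps add_divide_distrib)
  also have "\<dots> = ln m"
    using m assms by (simp add: m_def[symmetric])
  finally have "exp (a * ln u + b * ln v + c * ln z) \<le> m"
    using m by (metis exp_le_cancel_iff exp_ln)
  then show ?thesis
    using pos by (simp add: powr_def exp_add m_def)
qed

text \<open>Weighted AM-GM for the normalised functions \<open>u / U\<close>, \<open>v / V\<close>,
  \<open>z / Z\<close>, integrated: each has integral 1, so the right-hand side becomes
  \<open>a + b + c = 1\<close>. Zero exponents are allowed because \<open>lam1\<close> or
  \<open>lam2\<close> may be 0.\<close>

lemma nn_integral_Holder3:
  fixes u v z :: "'a \<Rightarrow> real" and a b c U V Z :: real
  assumes [measurable]: "u \<in> borel_measurable M" "v \<in> borel_measurable M" "z \<in> borel_measurable M"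
    and nn: "\<And>x. 0 \<le> u x" "\<And>x. 0 \<le> v x" "\<And>x. 0 \<le> z x"
    and int: "(\<integral>\<^sup>+x. u x \<partial>M) = ennreal U" "(\<integral>\<^sup>+x. v x \<partial>M) = ennreal V" "(\<integral>\<^sup>+x. z x \<partial>M) = ennreal Z"
    and pos: "0 < U" "0 < V" "0 < Z"
    and exps: "0 \<le> a" "0 \<le> b" "0 \<le> c" "a + b + c = 1"
  shows "(\<integral>\<^sup>+x. u x powr a * v x powr b * z x powr c \<partial>M)
    \<le> ennreal (U powr a * V powr b * Z powr c)"
proof -
  define P where "P = U powr a * V powr b * Z powr c"
  have P: "0 < P" using pos by (simp add: P_def)
  have "u x powr a * v x powr b * z x powr c
      \<le> P * a / U * u x + P * b / V * v x + P * c / Z * z x" for x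
  proof -
    have "u x powr a * v x powr b * z x powr c
        = P * ((u x / U) powr a * (v x / V) powr b * (z x / Z) powr c)"
      using pos nn by (simp add: P_def powr_divide)
    also have "\<dots> \<le> P * (a * (u x / U) + b * (v x / V) + c * (z x / Z))"
      using P pos nn exps by (intro mult_left_mono weighted_am_gm3) auto
    finally show ?thesis by (simp add: algebra_simps)
  qed
  then have "(\<integral>\<^sup>+x. u x powr a * v x powr b * z x powr c \<partial>M)
      \<le> (\<integral>\<^sup>+x. ennreal (P * a / U * u x + P * b / V * v x + P * c / Z * z x) \<partial>M)"
    by (intro nn_integral_mono ennreal_leI)
  also have "\<dots> = (\<integral>\<^sup>+x. ennreal (P * a / U) * u x + ennreal (P * b / V) * v x
      + ennreal (P * c / Z) * z x \<partial>M)"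
    using P pos nn exps
    by (intro nn_integral_cong) (simp add: ennreal_plus del: times_divide_eq_left flip: ennreal_mult)
  also have "\<dots> = ennreal (P * a / U) * ennreal U + ennreal (P * b / V) * ennreal V
      + ennreal (P * c / Z) * ennreal Z"
    by (simp add: nn_integral_add nn_integral_cmult int)
  also have "\<dots> = ennreal (P * a / U * U + P * b / V * V + P * c / Z * Z)"
    using P pos exps by (simp add: ennreal_plus flip: ennreal_mult)
  also have "P * a / U * U + P * b / V * V + P * c / Z * Z = P"
    using pos exps by (simp flip: distrib_left)
  finally show ?thesis by (simp add: P_def)
qed

section \<open>Powers in [0,\<infinity>], weights on balls, and an upper bound for Morrey
  norms\<close>

lemma ennpow_ennreal: "0 \<le> a \<Longrightarrow> ennpow (ennreal a) s = ennreal (a powr s)"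
  by (simp add: ennpow_def)

lemma ennpow_mono:
  assumes "a \<le> b" "0 \<le> s"
  shows "ennpow a s \<le> ennpow b s"
  using assms
  by (cases a; cases b) (auto simp: ennpow_def top_unique intro!: ennreal_leI powr_mono2)

text \<open>Local integrability gives measurability of \<open>w\<close> only after cutting off to
  compact sets; \<open>w\<close> is the pointwise limit of its cut-offs to the balls of radius
  \<open>k\<close>, which are eventually constant at each point.\<close>

lemma weight_measurable:
  assumes "weight w"
  shows "w \<in> borel_measurable lebesgue"
proof (rule borel_measurable_LIMSEQ_real)
  fix k :: nat
  show "(\<lambda>x. indicat_real (cball 0 (real k)) x * w x) \<in> borel_measurable lebesgue"
    using assms compact_cball unfolding weight_def set_integrable_def
    by (metis (no_types, lifting) borel_measurable_integrable real_scaleR_def measurable_cong)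
next
  fix x :: "real^'a"
  have "\<forall>\<^sub>F k in sequentially. indicat_real (cball 0 (real k)) x * w x = w x"
    using eventually_ge_at_top[of "nat \<lceil>norm x\<rceil>"]
    by eventually_elim (auto simp: nat_le_iff ceiling_le_iff)
  then show "(\<lambda>k. indicat_real (cball 0 (real k)) x * w x) \<longlonglongrightarrow> w x"
    by (rule tendsto_eventually)
qed

lemma emeasure_lebesgue_ball:
  fixes x :: "real^'n"
  assumes "0 < r"
  shows "emeasure lebesgue (ball x r) = ennreal (unit_ball_vol CARD('n) * r ^ CARD('n))"
  using assms emeasure_ball[of r x] by simp

text \<open>Finite, because the closed ball is compact; nonzero, because otherwise
  \<open>w > 0\<close> a.e. would make the ball a null set. Quotients by
  \<open>wmeasure w (ball x r)\<close> thus become quotients of positive reals.\<close>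

lemma weight_ball:
  fixes w :: "real^'n \<Rightarrow> real"
  assumes "weight w" "0 < r"
  obtains W where "0 < W" "wmeasure w (ball x r) = ennreal W"
proof -
  have [measurable]: "w \<in> borel_measurable lebesgue" using assms weight_measurable by blast
  have [measurable]: "ball x r \<in> sets lebesgue" by simp
  have "w absolutely_integrable_on cball x r"
    using assms compact_cball unfolding weight_def by blast
  then have fin: "(\<integral>\<^sup>+y. norm (indicat_real (cball x r) y *\<^sub>R w y) \<partial>lebesgue) < \<infinity>"
    unfolding set_integrable_def integrable_iff_bounded by simp
  have "wmeasure w (ball x r) \<le> (\<integral>\<^sup>+y. norm (indicat_real (cball x r) y *\<^sub>R w y) \<partial>lebesgue)"
    unfolding wmeasure_def
    by (intro nn_integral_mono) (auto simp: indicator_def intro!: ennreal_leI)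
  then have "wmeasure w (ball x r) < \<infinity>" using fin by (rule le_less_trans)
  moreover have "wmeasure w (ball x r) \<noteq> 0"
  proof
    assume "wmeasure w (ball x r) = 0"
    then have "AE y in lebesgue. ennreal (w y) * indicator (ball x r) y = 0"
      unfolding wmeasure_def by (subst (asm) nn_integral_0_iff_AE) measurable
    moreover have "AE y in lebesgue. 0 < w y" using assms unfolding weight_def by simp
    ultimately have "AE y in lebesgue. y \<notin> ball x r"
      by eventually_elim (auto simp: indicator_def split: if_splits)
    then have "emeasure lebesgue (ball x r) = 0"
      by (subst (asm) AE_iff_measurable[where N = "ball x r"]) auto
    moreover have "0 < unit_ball_vol (real CARD('n)) * r ^ CARD('n)" using assms by simp
    ultimately show False
      using assms by (simp add: emeasure_lebesgue_ball ennreal_eq_0_iff del: emeasure_completion)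
  qed
  ultimately show ?thesis
    using that by (cases "wmeasure w (ball x r)") (auto simp: less_le)
qed

text \<open>The hypothesis \<open>dom\<close> says \<open>f\<^sup>p w \<le> 1\<^sup>a w\<^sup>b f\<^sup>c\<close> with
  \<open>a + b + c = 1\<close>, which is what Hoelder's inequality needs.\<close>

lemma morrey_norm_le:
  fixes w f :: "real^'n \<Rightarrow> real" and p lam1 lam2 S :: real
  defines "c \<equiv> 1 - (lam1 + lam2) / real CARD('n)"
  assumes w: "weight w" and p: "1 \<le> p"
    and lam: "0 \<le> lam1" "0 \<le> lam2" "lam1 + lam2 < real CARD('n)"
    and f[measurable]: "f \<in> borel_measurable lebesgue" and f0: "\<And>y. 0 \<le> f y"
    and S: "0 < S" "(\<integral>\<^sup>+y. f y \<partial>lebesgue) = ennreal S"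
    and dom: "AE y in lebesgue. f y powr p * w y \<le> w y powr (lam2 / real CARD('n)) * f y powr c"
  shows "morrey_norm p (lam1, lam2) w f
    \<le> ennreal ((unit_ball_vol CARD('n) powr (lam1 / real CARD('n)) * S powr c) powr (1 / p))"
  unfolding morrey_norm_def
proof (rule SUP_least, clarsimp)
  fix x :: "real^'n" and r :: real
  assume r: "0 < r"
  define n where "n = real CARD('n)"
  have n: "0 < n" by (simp add: n_def)
  have [measurable]: "w \<in> borel_measurable lebesgue" using w weight_measurable by blast
  have [measurable]: "ball x r \<in> sets lebesgue" by simp
  define V where "V = unit_ball_vol CARD('n) * r ^ CARD('n)"
  have vol: "0 < unit_ball_vol CARD('n)" by simp
  have V: "0 < V" "emeasure lebesgue (ball x r) = ennreal V"
    using r vol unfolding V_def by (simp, intro emeasure_lebesgue_ball)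
  \<comment> \<open>The factor \<open>r powr lam1\<close> cancels against the one in the Morrey
    norm, so that only a dimensional constant is left.\<close>
  have Vpow: "V powr (lam1 / n) = unit_ball_vol CARD('n) powr (lam1 / n) * r powr lam1"
    using r vol n by (simp add: V_def powr_mult powr_powr n_def flip: powr_realpow)
  obtain W where W: "0 < W" "wmeasure w (ball x r) = ennreal W"
    using weight_ball[OF w r] .
  have wpos: "AE y in lebesgue. 0 < w y" using w by (simp add: weight_def)
  \<comment> \<open>\<open>?v\<close> uses the positive part because \<open>w\<close> is positive
    only almost everywhere, while \<open>nn_integral_Holder3\<close> wants nonnegativity at every
    point. The third factor \<open>f\<close> is not cut off to the ball: its total integral
    \<open>S\<close> serves all balls at once, which makes the bound uniform in \<open>x\<close> and
    \<open>r\<close>.\<close>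
  let ?u = "\<lambda>y. indicat_real (ball x r) y"
  let ?v = "\<lambda>y. max 0 (w y) * indicat_real (ball x r) y"
  have "(\<integral>\<^sup>+y\<in>ball x r. ennreal (\<bar>f y\<bar> powr p * w y) \<partial>lebesgue)
      \<le> (\<integral>\<^sup>+y. ?u y powr (lam1 / n) * ?v y powr (lam2 / n) * f y powr c \<partial>lebesgue)"
    using dom wpos f0
    by (intro nn_integral_mono_AE) (auto elim!: eventually_elim2 simp: n_def indicator_def)
  also have "\<dots> \<le> ennreal (V powr (lam1 / n) * W powr (lam2 / n) * S powr c)"
  proof (rule nn_integral_Holder3)
    show "?u \<in> borel_measurable lebesgue" "?v \<in> borel_measurable lebesgue" by measurable
    show "(\<integral>\<^sup>+y. ennreal (?u y) \<partial>lebesgue) = ennreal V"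
      using V by (simp add: ennreal_indicator)
    have "(\<integral>\<^sup>+y. ennreal (?v y) \<partial>lebesgue) = wmeasure w (ball x r)"
      unfolding wmeasure_def
      by (intro nn_integral_cong) (auto simp: indicator_def max_def ennreal_neg)
    then show "(\<integral>\<^sup>+y. ennreal (?v y) \<partial>lebesgue) = ennreal W" using W by simp
    show "0 \<le> c" "lam1 / n + lam2 / n + c = 1"
      using lam n by (auto simp: c_def n_def field_simps)
  qed (use V W S lam n f0 in auto)
  finally have "(\<integral>\<^sup>+y\<in>ball x r. ennreal (\<bar>f y\<bar> powr p * w y) \<partial>lebesgue)
      / (ennreal (r powr lam1) * ennpow (wmeasure w (ball x r)) (lam2 / n))
      \<le> ennreal (V powr (lam1 / n) * W powr (lam2 / n) * S powr c)
      / (ennreal (r powr lam1) * ennpow (wmeasure w (ball x r)) (lam2 / n))"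
    by (rule divide_right_mono_ennreal)
  also have "\<dots> = ennreal (unit_ball_vol CARD('n) powr (lam1 / n) * S powr c)"
    using W r by (simp add: ennpow_ennreal divide_ennreal Vpow flip: ennreal_mult)
  finally have "ennpow ((\<integral>\<^sup>+y\<in>ball x r. ennreal (\<bar>f y\<bar> powr p * w y) \<partial>lebesgue)
      / (ennreal (r powr lam1) * ennpow (wmeasure w (ball x r)) (lam2 / n))) (1 / p)
      \<le> ennpow (ennreal (unit_ball_vol CARD('n) powr (lam1 / n) * S powr c)) (1 / p)"
    using p by (intro ennpow_mono) auto
  then show "ennpow ((\<integral>\<^sup>+y\<in>ball x r. ennreal (\<bar>f y\<bar> powr p * w y) \<partial>lebesgue)
      / (ennreal (r powr lam1) * ennpow (wmeasure w (ball x r)) (lam2 / real CARD('n)))) (1 / p)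
      \<le> ennreal ((unit_ball_vol CARD('n) powr (lam1 / real CARD('n)) * S powr c) powr (1 / p))"
    by (simp add: ennpow_ennreal n_def)
qed

section \<open>Testing the weak-type bound on functions supported in a ball\<close>

lemma weak_morrey_norm_maximal_ge:
  fixes w f :: "real^'n \<Rightarrow> real" and p lam1 lam2 S V W :: real
  assumes r: "0 < r"
    and S: "0 < S" "(\<integral>\<^sup>+y\<in>ball x r. ennreal \<bar>f y\<bar> \<partial>lebesgue) = ennreal S"
    and V: "0 < V" "emeasure lebesgue (ball x r) = ennreal V"
    and W: "0 < W" "wmeasure w (ball x r) = ennreal W"
  shows "ennreal (((S / (2 * V)) powr p * W
      / (V powr (lam1 / real CARD('n)) * W powr (lam2 / real CARD('n)))) powr (1 / p))
    \<le> weak_morrey_norm p (lam1, lam2) w (maximal_function f)"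
proof -
  \<comment> \<open>Half the mean of \<bar>\<open>f\<close>\<bar> over the ball: the weak norm uses
    the strict level set, and at this level it fills the whole ball.\<close>
  define t where "t = S / (2 * V)"
  have t: "0 < t" using S V by (simp add: t_def)
  have "ennreal t < maximal_function f y" if y: "y \<in> ball x r" for y
  proof -
    have "ennreal t < ennreal (S / V)"
      using S V by (intro ennreal_lessI) (auto simp: t_def field_simps)
    also have "\<dots> = (\<integral>\<^sup>+y\<in>ball x r. ennreal \<bar>f y\<bar> \<partial>lebesgue) / emeasure lebesgue (ball x r)"
      using S V by (simp add: divide_ennreal)
    also have "\<dots> \<le> maximal_function f y"
      unfolding maximal_function_def
      by (rule SUP_upper2[where i = "(x, r)"]) (use y r in auto)
    finally show ?thesis .
  qed
  then have level: "{y \<in> ball x r. ennreal t < maximal_function f y} = ball x r" by blast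
  have "ennreal ((t powr p * W
      / (V powr (lam1 / real CARD('n)) * W powr (lam2 / real CARD('n)))) powr (1 / p))
    = ennpow (ennreal (t powr p) * wmeasure w {y \<in> ball x r. ennreal t < maximal_function f y}
          / (ennpow (emeasure lebesgue (ball x r)) (lam1 / real CARD('n))
             * ennpow (wmeasure w (ball x r)) (lam2 / real CARD('n)))) (1 / p)"
    using V W unfolding level
    by (simp add: ennpow_ennreal divide_ennreal flip: ennreal_mult)
  also have "\<dots> \<le> weak_morrey_norm p (lam1, lam2) w (maximal_function f)"
    unfolding weak_morrey_norm_def
    by (rule SUP_upper2[where i = "(x, r, t)"]) (use t r in auto)
  finally show ?thesis by (simp add: t_def)
qed

text \<open>The mass \<open>S\<close> of \<open>f\<close> controls both sides: the p-th power of the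
  Morrey norm is at most a constant times \<open>S powr c\<close>, whereas that of the weak norm
  grows with the p-th power of the mean \<open>S / V\<close>. Since \<open>S\<close> is positive and
  finite, \<open>S powr c\<close> can be divided out.\<close>

lemma truncated_dual_weight_bound:
  fixes w f :: "real^'n \<Rightarrow> real" and p lam1 lam2 C S V W :: real
  defines "a \<equiv> lam1 / real CARD('n)" and "b \<equiv> lam2 / real CARD('n)"
  defines "c \<equiv> 1 - (lam1 + lam2) / real CARD('n)"
  assumes w: "weight w" and p: "1 \<le> p"
    and lam: "0 \<le> lam1" "0 \<le> lam2" "lam1 + lam2 < real CARD('n)"
    and C: "0 < C" "\<And>f. f \<in> morrey_space p (lam1, lam2) w \<Longrightarrow>
      weak_morrey_norm p (lam1, lam2) w (maximal_function f)
        \<le> ennreal C * morrey_norm p (lam1, lam2) w f"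
    and f: "f \<in> borel_measurable lebesgue" "\<And>y. 0 \<le> f y" "\<And>y. y \<notin> ball x r \<Longrightarrow> f y = 0"
    and S: "0 < S" "(\<integral>\<^sup>+y. f y \<partial>lebesgue) = ennreal S"
    and dom: "AE y in lebesgue. f y powr p * w y \<le> w y powr b * f y powr c"
    and r: "0 < r"
    and V: "0 < V" "emeasure lebesgue (ball x r) = ennreal V"
    and W: "0 < W" "wmeasure w (ball x r) = ennreal W"
  shows "S powr (p - c)
    \<le> (2 * C) powr p * unit_ball_vol CARD('n) powr a * V powr (p + a) / W powr (1 - b)"
proof -
  define K where "K = unit_ball_vol CARD('n) powr a"
  have vol: "0 < unit_ball_vol CARD('n)" by simp
  have K: "0 < K" using less_imp_neq[OF vol] by (simp add: K_def)
  have norm: "morrey_norm p (lam1, lam2) w f \<le> ennreal ((K * S powr c) powr (1 / p))"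
    unfolding K_def a_def c_def
    using w p lam f S dom unfolding b_def c_def by (intro morrey_norm_le) auto
  then have mem: "f \<in> morrey_space p (lam1, lam2) w"
    using f unfolding morrey_space_def by (auto simp: le_less_trans)
  have ball: "(\<integral>\<^sup>+y\<in>ball x r. ennreal \<bar>f y\<bar> \<partial>lebesgue) = ennreal S"
    using f(2,3) unfolding S(2)[symmetric]
    by (intro nn_integral_cong) (auto simp: indicator_def)
  \<comment> \<open>The quantity under the p-th root in the weak norm, for the ball itself and the
    level \<open>S / (2 * V)\<close>.\<close>
  define L where "L = (S / (2 * V)) powr p * W / (V powr a * W powr b)"
  have L: "0 < L" using S V W by (simp add: L_def)
  have "ennreal (L powr (1 / p)) \<le> weak_morrey_norm p (lam1, lam2) w (maximal_function f)"
    unfolding L_def a_def b_def using r S(1) ball V W by (rule weak_morrey_norm_maximal_ge)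
  also have "\<dots> \<le> ennreal C * morrey_norm p (lam1, lam2) w f" using C mem by blast
  also have "\<dots> \<le> ennreal C * ennreal ((K * S powr c) powr (1 / p))"
    using norm by (rule mult_left_mono) simp
  also have "\<dots> = ennreal (C * (K * S powr c) powr (1 / p))" using C by (simp add: ennreal_mult)
  finally have "L powr (1 / p) \<le> C * (K * S powr c) powr (1 / p)"
    using C by (subst (asm) ennreal_le_iff) auto
  then have "(L powr (1 / p)) powr p \<le> (C * (K * S powr c) powr (1 / p)) powr p"
    using p by (intro powr_mono2) auto
  then have le: "L \<le> C powr p * (K * S powr c)"
    using p L C K S by (simp add: powr_powr powr_mult)
  \<comment> \<open>Here \<open>L\<close> is rewritten as
    \<open>S powr p * W powr (1 - b) / (2 powr p * V powr (p + a))\<close> and solved for the power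
    of \<open>S\<close>.\<close>
  have "S powr (p - c) = L * (2 powr p * V powr (p + a) / (S powr c * W powr (1 - b)))"
    using S V W by (simp add: L_def powr_divide powr_mult powr_add powr_diff)
  also have "\<dots> \<le> C powr p * (K * S powr c) * (2 powr p * V powr (p + a) / (S powr c * W powr (1 - b)))"
    using le V W S by (intro mult_right_mono) auto
  also have "\<dots> = (2 * C) powr p * K * V powr (p + a) / W powr (1 - b)"
    using S C by (simp add: powr_mult)
  finally show ?thesis by (simp add: K_def)
qed

section \<open>The mass of the dual weight on a ball\<close>

text \<open>The exponent of \<open>w\<close> is 1 - q' for the target q. The bound for the
  truncations does not depend on the truncation level, so monotone convergence passes it on to the
  dual weight and in particular shows that its mass is finite.\<close>

lemma nn_integral_dual_weight_ball_le:
  fixes w :: "real^'n \<Rightarrow> real" and p lam1 lam2 C V W :: real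
  defines "a \<equiv> lam1 / real CARD('n)" and "b \<equiv> lam2 / real CARD('n)"
  defines "c \<equiv> 1 - (lam1 + lam2) / real CARD('n)"
  assumes w: "weight w" and p: "1 \<le> p"
    and lam: "0 \<le> lam1" "0 \<le> lam2" "0 < lam1 + lam2" "lam1 + lam2 < real CARD('n)"
    and C: "0 < C" "\<And>f. f \<in> morrey_space p (lam1, lam2) w \<Longrightarrow>
      weak_morrey_norm p (lam1, lam2) w (maximal_function f)
        \<le> ennreal C * morrey_norm p (lam1, lam2) w f"
    and r: "0 < r"
    and V: "0 < V" "emeasure lebesgue (ball x r) = ennreal V"
    and W: "0 < W" "wmeasure w (ball x r) = ennreal W"
  shows "wmeasure (\<lambda>y. w y powr (- ((1 - b) / (p - c)))) (ball x r)
    \<le> ennreal (((2 * C) powr p * unit_ball_vol CARD('n) powr a * V powr (p + a)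
        / W powr (1 - b)) powr (1 / (p - c)))" (is "_ \<le> ennreal ?R")
proof -
  have [measurable]: "w \<in> borel_measurable lebesgue" using w weight_measurable by blast
  have [measurable]: "ball x r \<in> sets lebesgue" by simp
  have wpos: "AE y in lebesgue. 0 < w y" using w by (simp add: weight_def)
  have n: "0 < real CARD('n)" by simp
  \<comment> \<open>This is where \<open>0 < lam1 + lam2\<close> enters: it gives
    \<open>c < 1\<close>, hence \<open>c < p\<close> even for \<open>p = 1\<close>.\<close>
  have "0 < (lam1 + lam2) / real CARD('n)" using lam n by simp
  then have pc: "0 < p - c" using p by (simp add: c_def)
  have b1: "0 < 1 - b" using lam n by (simp add: b_def field_simps)
  define s where "s = (\<lambda>y. w y powr (- ((1 - b) / (p - c))))"
  have [measurable]: "s \<in> borel_measurable lebesgue" unfolding s_def by measurable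
  define f where "f k y = min (s y) (real (Suc k)) * indicat_real (ball x r) y" for k y
  have [measurable]: "f k \<in> borel_measurable lebesgue" for k unfolding f_def by measurable
  have s0: "0 \<le> s y" for y by (simp add: s_def)
  have f0: "0 \<le> f k y" for k y by (simp add: f_def s0)
  have le: "(\<integral>\<^sup>+y. f k y \<partial>lebesgue) \<le> ennreal ?R" for k
  proof -
    have "(\<integral>\<^sup>+y. f k y \<partial>lebesgue) \<le> (\<integral>\<^sup>+y. ennreal (Suc k) * indicator (ball x r) y \<partial>lebesgue)"
      by (intro nn_integral_mono) (auto simp: f_def indicator_def simp del: of_nat_Suc intro!: ennreal_leI)
    also have "\<dots> = ennreal (Suc k) * ennreal V" using V by (simp add: nn_integral_cmult)
    also have "\<dots> < \<infinity>" by (simp add: ennreal_mult_less_top)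
    finally have fin: "(\<integral>\<^sup>+y. f k y \<partial>lebesgue) < \<infinity>" .
    show ?thesis
    \<comment> \<open>The test requires positive mass; for mass 0 the bound is trivial.\<close>
    proof (cases "(\<integral>\<^sup>+y. f k y \<partial>lebesgue) = 0")
      case False
      with fin obtain S where S: "0 < S" "(\<integral>\<^sup>+y. f k y \<partial>lebesgue) = ennreal S"
        by (cases "\<integral>\<^sup>+y. f k y \<partial>lebesgue") (auto simp: less_le)
      \<comment> \<open>Truncation only lowers \<open>s\<close>, and \<open>p - c > 0\<close>, so
        \<open>f k y powr (p - c)\<close> is at most
        \<open>s y powr (p - c) = w y powr (b - 1)\<close>. Multiplying by
        \<open>w y * f k y powr c\<close> gives the claim.\<close>
      have "AE y in lebesgue. f k y powr p * w y \<le> w y powr b * f k y powr c"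
        using wpos
      proof eventually_elim
        case (elim y)
        show ?case
        proof (cases "f k y = 0")
          case False
          then have pos: "0 < f k y" using f0[of k y] by simp
          have "f k y \<le> s y" by (auto simp: f_def indicator_def s0)
          then have "f k y powr (p - c) \<le> s y powr (p - c)"
            using pos pc by (intro powr_mono2) auto
          also have "\<dots> = w y powr (b - 1)"
            using pc by (simp add: s_def powr_powr)
          finally have "f k y powr (p - c) * (w y * f k y powr c) \<le> w y powr (b - 1) * (w y * f k y powr c)"
            using elim by (intro mult_right_mono) auto
          then show ?thesis
            using elim pos by (simp add: powr_diff field_simps)
        qed simp
      qed
      then have "S powr (p - c)
          \<le> (2 * C) powr p * unit_ball_vol CARD('n) powr a * V powr (p + a) / W powr (1 - b)"
        unfolding a_def b_def c_def using w p lam C r V W S f0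
        by (intro truncated_dual_weight_bound[where f = "f k" and x = x and r = r and w = w])
          (auto simp: f_def)
      then have "(S powr (p - c)) powr (1 / (p - c)) \<le> ?R"
        using pc by (intro powr_mono2) auto
      then have "S \<le> ?R" using S pc by (simp add: powr_powr)
      then show ?thesis using S by (simp add: ennreal_leI)
    qed simp
  qed
  have sup: "(SUP k. ennreal (f k y)) = ennreal (s y) * indicator (ball x r) y" for y
  proof (rule antisym)
    show "(SUP k. ennreal (f k y)) \<le> ennreal (s y) * indicator (ball x r) y"
      by (intro SUP_least) (auto simp: f_def indicator_def intro!: ennreal_leI)
    \<comment> \<open>The supremum is attained: a truncation level above \<open>s y\<close> no
      longer changes the value.\<close>
    obtain k where "s y \<le> real k" using real_arch_simple by blast
    then have "ennreal (s y) * indicator (ball x r) y = ennreal (f k y)"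
      by (auto simp: f_def indicator_def min_def)
    then show "ennreal (s y) * indicator (ball x r) y \<le> (SUP k. ennreal (f k y))"
      by (auto intro: SUP_upper2)
  qed
  have "wmeasure s (ball x r) = (\<integral>\<^sup>+y. (SUP k. ennreal (f k y)) \<partial>lebesgue)"
    unfolding wmeasure_def sup ..
  also have "\<dots> = (SUP k. \<integral>\<^sup>+y. ennreal (f k y) \<partial>lebesgue)"
  proof (rule nn_integral_monotone_convergence_SUP)
    show "incseq (\<lambda>k y. ennreal (f k y))"
      by (auto simp: incseq_def le_fun_def f_def indicator_def intro!: ennreal_leI)
  qed measurable
  also have "\<dots> \<le> ennreal ?R" using le by (intro SUP_least)
  finally show ?thesis by (simp add: s_def)
qed

section \<open>From the bound on balls to the Muckenhoupt condition\<close>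

theorem proposition3p1:
  fixes w :: "real^'n \<Rightarrow> real" and p lam1 lam2 :: real
  assumes "weight w"
    and "1 \<le> p"
    and "0 \<le> lam1" and "0 \<le> lam2"
    and "0 < lam1 + lam2" and "lam1 + lam2 < real CARD('n)"
    and "maximal_bounded_weak p (lam1, lam2) w"
  shows "w \<in> muckenhoupt ((real CARD('n) * p + lam1) / (real CARD('n) - lam2))"
proof -
  define n where "n = real CARD('n)"
  define a where "a = lam1 / n"
  define b where "b = lam2 / n"
  define c where "c = 1 - (lam1 + lam2) / n"
  define q where "q = (n * p + lam1) / (n - lam2)"
  have n: "0 < n" by (simp add: n_def)
  have b1: "0 < 1 - b" using assms n by (simp add: b_def n_def field_simps)
  have "0 < (lam1 + lam2) / n" using assms n by simp
  then have pc: "0 < p - c" using assms by (simp add: c_def)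
  have nl: "0 < n - lam2" using assms by (simp add: n_def)
  have q: "q = (p + a) / (1 - b)"
    using n nl by (simp add: q_def a_def b_def field_simps)
  have abc: "a + b + c = 1" using n by (simp add: a_def b_def c_def field_simps)
  \<comment> \<open>From \<open>a + c = 1 - b\<close> it follows that
    \<open>(p + a) - (1 - b) = p - c\<close>. This is what makes the exponent of the dual weight
    agree with 1 - q'.\<close>
  then have q1: "q - 1 = (p - c) / (1 - b)"
    unfolding q using b1 by (simp add: field_simps)
  have qpos: "0 < q - 1" using q1 b1 pc by simp
  have dual: "1 - q / (q - 1) = - ((1 - b) / (p - c))"
  proof -
    have "1 - q / (q - 1) = - (1 / (q - 1))" using qpos by (simp add: field_simps)
    then show ?thesis unfolding q1 by simp
  qed
  obtain C0 where C0: "0 \<le> C0" "\<And>f. f \<in> morrey_space p (lam1, lam2) w \<Longrightarrow>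
      weak_morrey_norm p (lam1, lam2) w (maximal_function f)
        \<le> ennreal C0 * morrey_norm p (lam1, lam2) w f"
    using assms unfolding maximal_bounded_weak_def by blast
  \<comment> \<open>Adding 1 makes the constant strictly positive, so that \<open>D\<close> below is
    positive.\<close>
  define C where "C = C0 + 1"
  have "ennreal C0 * m \<le> ennreal C * m" for m
    by (intro mult_right_mono ennreal_leI) (auto simp: C_def)
  then have C: "0 < C" "\<And>f. f \<in> morrey_space p (lam1, lam2) w \<Longrightarrow>
      weak_morrey_norm p (lam1, lam2) w (maximal_function f)
        \<le> ennreal C * morrey_norm p (lam1, lam2) w f"
    using C0 by (auto simp: C_def intro: order_trans)
  define D where "D = (2 * C) powr p * unit_ball_vol CARD('n) powr a"
  have vol: "0 < unit_ball_vol CARD('n)" by simp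
  have D: "0 < D" using C less_imp_neq[OF vol] by (simp add: D_def)
  have bound: "(wmeasure w (ball x r) / emeasure lebesgue (ball x r))
      * ennpow (wmeasure (\<lambda>y. w y powr (1 - q / (q - 1))) (ball x r)
                / emeasure lebesgue (ball x r)) (q - 1) \<le> ennreal (D powr (1 / (1 - b)))"
    if r: "0 < r" for x r
  proof -
    obtain W where W: "0 < W" "wmeasure w (ball x r) = ennreal W"
      using weight_ball[OF assms(1) r] .
    define V where "V = unit_ball_vol CARD('n) * r ^ CARD('n)"
    have V: "0 < V" "emeasure lebesgue (ball x r) = ennreal V"
      using r unfolding V_def by (simp, intro emeasure_lebesgue_ball)
    define R where "R = (D * V powr (p + a) / W powr (1 - b)) powr (1 / (p - c))"
    have R0: "0 \<le> R" by (simp add: R_def)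
    have "wmeasure (\<lambda>y. w y powr (1 - q / (q - 1))) (ball x r) \<le> ennreal R"
      unfolding dual R_def D_def a_def b_def c_def n_def
      using assms(1-6) C r V W by (intro nn_integral_dual_weight_ball_le) auto
    then have "wmeasure (\<lambda>y. w y powr (1 - q / (q - 1))) (ball x r) / emeasure lebesgue (ball x r)
        \<le> ennreal R / ennreal V"
      unfolding V(2) by (rule divide_right_mono_ennreal)
    also have "\<dots> = ennreal (R / V)" using R0 V by (simp add: divide_ennreal)
    finally have "ennpow (wmeasure (\<lambda>y. w y powr (1 - q / (q - 1))) (ball x r)
        / emeasure lebesgue (ball x r)) (q - 1) \<le> ennpow (ennreal (R / V)) (q - 1)"
      using qpos by (intro ennpow_mono) auto
    then have "(wmeasure w (ball x r) / emeasure lebesgue (ball x r))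
        * ennpow (wmeasure (\<lambda>y. w y powr (1 - q / (q - 1))) (ball x r)
                / emeasure lebesgue (ball x r)) (q - 1)
        \<le> (wmeasure w (ball x r) / emeasure lebesgue (ball x r)) * ennpow (ennreal (R / V)) (q - 1)"
      by (rule mult_left_mono) simp
    also have "\<dots> = ennreal (W / V * (R / V) powr (q - 1))"
      using R0 V W by (simp add: divide_ennreal ennpow_ennreal flip: ennreal_mult)
    \<comment> \<open>The exponents match: raising \<open>R\<close> to
      \<open>q - 1 = (p - c) / (1 - b)\<close> produces exactly \<open>V powr q / W\<close> besides
      the constant. All dependence on the ball cancels.\<close>
    also have "W / V * (R / V) powr (q - 1) = D powr (1 / (1 - b))"
    proof -
      have "R powr (q - 1) = (D * V powr (p + a) / W powr (1 - b)) powr (1 / (1 - b))"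
        unfolding R_def q1 using pc by (simp add: powr_powr)
      also have "\<dots> = D powr (1 / (1 - b)) * V powr q / W"
        using D V W b1 by (simp add: powr_divide powr_mult powr_powr q)
      finally have "W * R powr (q - 1) = D powr (1 / (1 - b)) * V powr q" using W by simp
      moreover have "V * V powr (q - 1) = V powr q" using V by (simp add: powr_diff)
      moreover have "0 < V powr q" using V by simp
      ultimately show ?thesis using R0 V by (simp add: powr_divide)
    qed
    finally show ?thesis .
  qed
  have "(SUP (x, r) \<in> UNIV \<times> {0<..}.
      (wmeasure w (ball x r) / emeasure lebesgue (ball x r))
      * ennpow (wmeasure (\<lambda>y. w y powr (1 - q / (q - 1))) (ball x r)
                / emeasure lebesgue (ball x r)) (q - 1)) \<le> ennreal (D powr (1 / (1 - b)))"
    using bound by (intro SUP_least) auto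
  then have "w \<in> muckenhoupt q"
    using assms(1) qpos unfolding muckenhoupt_def by (auto simp: le_less_trans)
  then show ?thesis by (simp add: q_def n_def)
qed

end
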